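(* Let $U$ be the $\gamma$-unitization of the GPEA $P$ and let $\sim$ be a congruence on $P$. Then $\sim^*$ is a congruence on $U$ iff $\sim$ is a $\gamma$-congruence that satisfies (C4) and (C5$'$).
   Context: $P$ is a GPEA (partial $\oplus$, constant $0$; partial associativity; conjugation; two-sided cancellation; neutral $0$; positivity), ordered by $a\le b$ iff $a\oplus c=b$ for some $c$; for $a\le b$, $a/b$ is the unique $c$ with $a\oplus c=b$ and $b\backslash a$ the unique $d$ with $d\oplus a=b$. $\gamma$ is a unitizing GPEA-automorphism ($\gamma a\oplus b$ defined iff $b\oplus a$ defined). The $\gamma$-unitization $U=P\cup P^\eta$ ($\eta$ a bijection of $P$ onto a disjoint set $P^\eta$, $1:=\eta0$): sums in $P$ as in $P$; $a+\eta b$ defined iff $a\le b$, equal to $\eta(b\backslash a)$; $\eta a+b$ defined iff $\gamma b\le a$, equal to $\eta(\gamma b/a)$; no sums within $P^\eta$. $U$ is a pseudo effect algebra with $\eta a=a^\sim$, $\gamma a=a^{--}$. A relation $\sim$ is a congruence iff (C1) it is an equivalence, (C2) $a\oplus b$, $a_1\oplus b_1$ exist, $a\sim a_1$, $b\sim b_1$ imply $a\oplus b\sim a_1\oplus b_1$, (C3) if $a\oplus b$ exists, for any $a_1\sim a$ there is $b_1\sim b$ with $a_1\oplus b_1$ existing, and for any $b_2\sim b$ there is $a_2\sim a$ with $a_2\oplus b_2$ existing. (C4): if $a\sim b$ and either $a\oplus a_1\sim b\oplus b_1$ or $a_1\oplus a\sim b_1\oplus b$, then $a_1\sim b_1$.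 (C5$'$): $a\sim b\oplus c$ implies $a=a_1\oplus a_2$ with $a_1\sim b$, $a_2\sim c$. $\sim$ is a $\gamma$-congruence iff $a\sim b\Leftrightarrow\gamma a\sim\gamma b$. $\sim^*$ on $U$: $a\sim^*b$ iff $a\sim b$, $\eta a\sim^*\eta b$ iff $a\sim b$ ($a,b\in P$), and no element of $P$ is related to an element of $P^\eta$. *)

theory Defs
  imports Main
begin

text \<open>
  A partial binary operation on \<open>'a\<close> is a function into \<open>'a option\<close>; \<open>a \<oplus> b = None\<close> means that
  the sum is undefined.
\<close>

locale gpea =
  fixes oplus :: "'a \<Rightarrow> 'a \<Rightarrow> 'a option"  (infixl "\<oplus>" 65)
    and zero :: 'a
  assumes
    \<comment> \<open>one side is defined iff the other one is, and then both are equal\<close>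
    associativity: "Option.bind (a \<oplus> b) (\<lambda>s. s \<oplus> c) = Option.bind (b \<oplus> c) (\<lambda>t. a \<oplus> t)"
    and conjugation: "a \<oplus> b = Some s \<Longrightarrow> \<exists>d e. d \<oplus> a = Some s \<and> b \<oplus> e = Some s"
    and left_cancellation: "a \<oplus> b = Some s \<Longrightarrow> a \<oplus> c = Some s \<Longrightarrow> b = c"
    and right_cancellation: "b \<oplus> a = Some s \<Longrightarrow> c \<oplus> a = Some s \<Longrightarrow> b = c"
    and neutral_right: "a \<oplus> zero = Some a"
    and neutral_left: "zero \<oplus> a = Some a"
    and positivity: "a \<oplus> b = Some zero \<Longrightarrow> a = zero \<and> b = zero"

definition le :: "('a \<Rightarrow> 'a \<Rightarrow> 'a option) \<Rightarrow> 'a \<Rightarrow> 'a \<Rightarrow> bool" where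
  "le oplus a b \<longleftrightarrow> (\<exists>c. oplus a c = Some b)"

text \<open>
  \<open>left_diff oplus a b\<close> is the \<open>a / b\<close> of the literature and \<open>right_diff oplus b a\<close> is \<open>b \<setminus> a\<close>;
  both are meaningful only if \<open>le oplus a b\<close>.
\<close>

definition left_diff :: "('a \<Rightarrow> 'a \<Rightarrow> 'a option) \<Rightarrow> 'a \<Rightarrow> 'a \<Rightarrow> 'a" where
  "left_diff oplus a b = (THE c. oplus a c = Some b)"

definition right_diff :: "('a \<Rightarrow> 'a \<Rightarrow> 'a option) \<Rightarrow> 'a \<Rightarrow> 'a \<Rightarrow> 'a" where
  "right_diff oplus b a = (THE d. oplus d a = Some b)"

definition gpea_morphism ::
    "('a \<Rightarrow> 'a \<Rightarrow> 'a option) \<Rightarrow> ('b \<Rightarrow> 'b \<Rightarrow> 'b option) \<Rightarrow> ('a \<Rightarrow> 'b) \<Rightarrow> bool" where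
  "gpea_morphism oplus oplus' f \<longleftrightarrow>
     (\<forall>a b s. oplus a b = Some s \<longrightarrow> oplus' (f a) (f b) = Some (f s))"

definition gpea_automorphism :: "('a \<Rightarrow> 'a \<Rightarrow> 'a option) \<Rightarrow> ('a \<Rightarrow> 'a) \<Rightarrow> bool" where
  "gpea_automorphism oplus f \<longleftrightarrow>
     bij f \<and> gpea_morphism oplus oplus f \<and> gpea_morphism oplus oplus (inv f)"

definition unitizing_automorphism :: "('a \<Rightarrow> 'a \<Rightarrow> 'a option) \<Rightarrow> ('a \<Rightarrow> 'a) \<Rightarrow> bool" where
  "unitizing_automorphism oplus \<gamma> \<longleftrightarrow>
     gpea_automorphism oplus \<gamma> \<and> (\<forall>a b. oplus (\<gamma> a) b \<noteq> None \<longleftrightarrow> oplus b a \<noteq> None)"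

text \<open>
  The carrier of the unitization is the disjoint union of a copy of \<open>'a\<close> (constructor \<open>Elem\<close>,
  the inclusion) and the set of all \<open>Eta a\<close>; the constructor \<open>Eta\<close> is the bijection \<open>\<eta>\<close>.
\<close>

datatype 'a unitization = Elem 'a | Eta 'a

fun unitization_plus ::
    "('a \<Rightarrow> 'a \<Rightarrow> 'a option) \<Rightarrow> ('a \<Rightarrow> 'a) \<Rightarrow>
     'a unitization \<Rightarrow> 'a unitization \<Rightarrow> 'a unitization option" where
  "unitization_plus oplus \<gamma> (Elem a) (Elem b) = map_option Elem (oplus a b)"
| "unitization_plus oplus \<gamma> (Elem a) (Eta b) =
     (if le oplus a b then Some (Eta (right_diff oplus b a)) else None)"
| "unitization_plus oplus \<gamma> (Eta a) (Elem b) =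
     (if le oplus (\<gamma> b) a then Some (Eta (left_diff oplus (\<gamma> b) a)) else None)"
| "unitization_plus oplus \<gamma> (Eta a) (Eta b) = None"

definition C1 :: "('a \<Rightarrow> 'a \<Rightarrow> bool) \<Rightarrow> bool" where
  "C1 sim \<longleftrightarrow> equivp sim"

definition C2 :: "('a \<Rightarrow> 'a \<Rightarrow> 'a option) \<Rightarrow> ('a \<Rightarrow> 'a \<Rightarrow> bool) \<Rightarrow> bool" where
  "C2 oplus sim \<longleftrightarrow>
     (\<forall>a b a1 b1 s s1. oplus a b = Some s \<and> oplus a1 b1 = Some s1 \<and> sim a a1 \<and> sim b b1
        \<longrightarrow> sim s s1)"

definition C3 :: "('a \<Rightarrow> 'a \<Rightarrow> 'a option) \<Rightarrow> ('a \<Rightarrow> 'a \<Rightarrow> bool) \<Rightarrow> bool" where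
  "C3 oplus sim \<longleftrightarrow>
     (\<forall>a b. oplus a b \<noteq> None \<longrightarrow>
        (\<forall>a1. sim a1 a \<longrightarrow> (\<exists>b1. sim b1 b \<and> oplus a1 b1 \<noteq> None)) \<and>
        (\<forall>b2. sim b2 b \<longrightarrow> (\<exists>a2. sim a2 a \<and> oplus a2 b2 \<noteq> None)))"

definition congruence :: "('a \<Rightarrow> 'a \<Rightarrow> 'a option) \<Rightarrow> ('a \<Rightarrow> 'a \<Rightarrow> bool) \<Rightarrow> bool" where
  "congruence oplus sim \<longleftrightarrow> C1 sim \<and> C2 oplus sim \<and> C3 oplus sim"

text \<open>In the next two conditions, \<open>x \<sim> y\<close> for sums \<open>x, y\<close> includes that these sums are defined.\<close>

definition C4 :: "('a \<Rightarrow> 'a \<Rightarrow> 'a option) \<Rightarrow> ('a \<Rightarrow> 'a \<Rightarrow> bool) \<Rightarrow> bool" where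
  "C4 oplus sim \<longleftrightarrow>
     (\<forall>a b a1 b1. sim a b \<and>
        ((\<exists>s t. oplus a a1 = Some s \<and> oplus b b1 = Some t \<and> sim s t) \<or>
         (\<exists>s t. oplus a1 a = Some s \<and> oplus b1 b = Some t \<and> sim s t))
        \<longrightarrow> sim a1 b1)"

definition C5' :: "('a \<Rightarrow> 'a \<Rightarrow> 'a option) \<Rightarrow> ('a \<Rightarrow> 'a \<Rightarrow> bool) \<Rightarrow> bool" where
  "C5' oplus sim \<longleftrightarrow>
     (\<forall>a b c s. oplus b c = Some s \<and> sim a s
        \<longrightarrow> (\<exists>a1 a2. oplus a1 a2 = Some a \<and> sim a1 b \<and> sim a2 c))"

definition gamma_congruence ::
    "('a \<Rightarrow> 'a \<Rightarrow> 'a option) \<Rightarrow> ('a \<Rightarrow> 'a) \<Rightarrow> ('a \<Rightarrow> 'a \<Rightarrow> bool) \<Rightarrow> bool" where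
  "gamma_congruence oplus \<gamma> sim \<longleftrightarrow>
     congruence oplus sim \<and> (\<forall>a b. sim a b \<longleftrightarrow> sim (\<gamma> a) (\<gamma> b))"

fun sim_star :: "('a \<Rightarrow> 'a \<Rightarrow> bool) \<Rightarrow> 'a unitization \<Rightarrow> 'a unitization \<Rightarrow> bool" where
  "sim_star sim (Elem a) (Elem b) \<longleftrightarrow> sim a b"
| "sim_star sim (Eta a) (Eta b) \<longleftrightarrow> sim a b"
| "sim_star sim (Elem a) (Eta b) \<longleftrightarrow> False"
| "sim_star sim (Eta a) (Elem b) \<longleftrightarrow> False"

end

theory Submission imports Defs begin

text \<open>
  The sums of the unitization are relations of \<open>P\<close> read differently: \<open>a + \<eta> b = \<eta> d\<close> means
  \<open>d \<oplus> a = b\<close>, and \<open>\<eta> a + b = \<eta> d\<close> means \<open>\<gamma> b \<oplus> d = a\<close>. Under this reading (C2) for mixed sums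
  is (C4), and the half of (C3) that replaces the summand in \<open>P\<^sup>\<eta>\<close> is (C5'). The remaining point is
  that a congruence on \<open>U\<close> is compatible with \<open>\<gamma>\<close>; this comes from (C3) applied to
  \<open>\<eta> a + \<gamma>\<^sup>-\<^sup>1 a = \<eta> 0\<close>, where the resulting error term \<open>y \<sim> 0\<close> is absorbed by (C2).
\<close>

section \<open>Sums of the unitization as equations in P\<close>

context gpea
begin

abbreviation uplus where
  "uplus \<equiv> unitization_plus oplus"

text \<open>Conjugation moves the complement to the other side. \<open>Elem a + Eta b\<close> is
  guarded by \<open>le\<close>, a condition on right summands, but its value
  \<open>right_diff\<close> is a left summand.\<close>

lemma le_iff_left_summand: "le oplus a b \<longleftrightarrow> (\<exists>d. d \<oplus> a = Some b)"
  unfolding le_def by (metis conjugation)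

lemma left_diff_eq: "a \<oplus> c = Some b \<Longrightarrow> left_diff oplus a b = c"
  unfolding left_diff_def by (blast intro: left_cancellation)

lemma right_diff_eq: "d \<oplus> a = Some b \<Longrightarrow> right_diff oplus b a = d"
  unfolding right_diff_def by (blast intro: right_cancellation)

lemma uplus_Elem_Elem_iff:
  "uplus \<gamma> (Elem a) (Elem b) = Some u \<longleftrightarrow> (\<exists>c. u = Elem c \<and> a \<oplus> b = Some c)"
  by auto

lemma uplus_Elem_Eta_iff:
  "uplus \<gamma> (Elem a) (Eta b) = Some u \<longleftrightarrow> (\<exists>d. u = Eta d \<and> d \<oplus> a = Some b)"
  by (auto simp: le_iff_left_summand right_diff_eq dest: right_cancellation)

lemma uplus_Eta_Elem_iff:
  "uplus \<gamma> (Eta a) (Elem b) = Some u \<longleftrightarrow> (\<exists>d. u = Eta d \<and> \<gamma> b \<oplus> d = Some a)"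
  by (auto simp: le_def left_diff_eq dest: left_cancellation)

lemmas uplus_iffs = uplus_Elem_Elem_iff uplus_Elem_Eta_iff uplus_Eta_Elem_iff

text \<open>\<open>zero \<oplus> zero = zero\<close> gives
  \<open>f zero \<oplus> f zero = f zero\<close>; cancel against
  \<open>f zero \<oplus> zero = f zero\<close>.\<close>

lemma morphism_zero:
  assumes "gpea_morphism oplus oplus f"
  shows "f zero = zero"
  using assms unfolding gpea_morphism_def
  by (metis left_cancellation neutral_left neutral_right)

end

section \<open>The lifted relation and rules for working with congruences\<close>

lemma C1_sim_star:
  assumes "C1 sim"
  shows "C1 (sim_star sim)"
proof -
  have eq: "equivp sim" using assms by (simp add: C1_def)
  show ?thesis
    unfolding C1_def
  proof (rule equivpI)
    show "reflp (sim_star sim)"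
    proof (rule reflpI)
      show "sim_star sim u u" for u
        by (cases u) (auto intro: equivp_reflp[OF eq])
    qed
    show "symp (sim_star sim)"
    proof (rule sympI)
      show "sim_star sim v u" if "sim_star sim u v" for u v
        using that by (cases u; cases v) (auto intro: equivp_symp[OF eq])
    qed
    show "transp (sim_star sim)"
    proof (rule transpI)
      show "sim_star sim u w" if "sim_star sim u v" "sim_star sim v w" for u v w
        using that by (cases u; cases v; cases w) (auto intro: equivp_transp[OF eq])
    qed
  qed
qed

lemma sim_star_Elem_right: "sim_star sim u (Elem a) \<longleftrightarrow> (\<exists>b. u = Elem b \<and> sim b a)"
  by (cases u) auto

lemma sim_star_Eta_right: "sim_star sim u (Eta a) \<longleftrightarrow> (\<exists>b. u = Eta b \<and> sim b a)"
  by (cases u) auto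

lemma C2D:
  assumes "C2 oplus sim" "oplus a b = Some s" "oplus a1 b1 = Some s1" "sim a a1" "sim b b1"
  shows "sim s s1"
  using assms unfolding C2_def by blast

lemma C3_leftD:
  assumes "C3 oplus sim" "oplus a b = Some s" "sim a1 a"
  obtains b1 t where "sim b1 b" "oplus a1 b1 = Some t"
  using assms unfolding C3_def by (metis option.exhaust option.distinct(1))

lemma C3_rightD:
  assumes "C3 oplus sim" "oplus a b = Some s" "sim b1 b"
  obtains a1 t where "sim a1 a" "oplus a1 b1 = Some t"
  using assms unfolding C3_def by (metis option.exhaust option.distinct(1))

lemma C3I:
  assumes "\<And>a b s a1. oplus a b = Some s \<Longrightarrow> sim a1 a \<Longrightarrow> \<exists>b1 t. sim b1 b \<and> oplus a1 b1 = Some t"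
    and "\<And>a b s b1. oplus a b = Some s \<Longrightarrow> sim b1 b \<Longrightarrow> \<exists>a1 t. sim a1 a \<and> oplus a1 b1 = Some t"
  shows "C3 oplus sim"
  using assms unfolding C3_def by fast

locale gpea_congruence = gpea +
  fixes \<gamma> :: "'a \<Rightarrow> 'a" and sim :: "'a \<Rightarrow> 'a \<Rightarrow> bool"
  assumes gamma: "unitizing_automorphism oplus \<gamma>"
    and cong: "congruence oplus sim"
begin

lemma equiv: "equivp sim" and c2: "C2 oplus sim" and c3: "C3 oplus sim"
  using cong by (simp_all add: congruence_def C1_def)

lemma sim_refl: "sim a a"
  and sim_sym: "sim a b \<Longrightarrow> sim b a"
  and sim_trans: "sim a b \<Longrightarrow> sim b c \<Longrightarrow> sim a c"
  using equiv by (blast intro: equivp_reflp equivp_symp equivp_transp)+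

lemma bij_gamma: "bij \<gamma>"
  and gamma_morphism: "gpea_morphism oplus oplus \<gamma>"
  and inv_gamma_morphism: "gpea_morphism oplus oplus (inv \<gamma>)"
  using gamma by (simp_all add: unitizing_automorphism_def gpea_automorphism_def)

lemma gamma_inv [simp]: "\<gamma> (inv \<gamma> a) = a"
  using bij_gamma by (simp add: bij_is_surj surj_f_inv_f)

lemma inv_gamma [simp]: "inv \<gamma> (\<gamma> a) = a"
  using bij_gamma by (simp add: bij_is_inj)

text \<open>C2 compares \<open>a \<oplus> zero = a\<close> with
  \<open>a \<oplus> y = b\<close>.\<close>

lemma sim_of_sum_negligible:
  assumes "a \<oplus> y = Some b" "sim y zero"
  shows "sim a b"
  using C2D[OF c2 neutral_right assms(1) sim_refl] assms(2) sim_sym by blast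

section \<open>Sufficiency: the lifted relation is a congruence on U\<close>

lemma congruence_sim_star:
  assumes g: "\<And>a b. sim a b \<longleftrightarrow> sim (\<gamma> a) (\<gamma> b)"
    and c4: "C4 oplus sim" and c5: "C5' oplus sim"
  shows "congruence (uplus \<gamma>) (sim_star sim)"
  unfolding congruence_def
proof (intro conjI)
  show "C1 (sim_star sim)"
    using equiv by (intro C1_sim_star) (simp add: C1_def)
  have cancel_left: "sim x y" if "a \<oplus> x = Some s" "b \<oplus> y = Some t" "sim a b" "sim s t"
    for a b x y s t using c4 that unfolding C4_def by blast
  have cancel_right: "sim x y" if "x \<oplus> a = Some s" "y \<oplus> b = Some t" "sim a b" "sim s t"
    for a b x y s t using c4 that unfolding C4_def by blast
  have split: "\<exists>a1 a2. a1 \<oplus> a2 = Some a \<and> sim a1 b \<and> sim a2 c" if "b \<oplus> c = Some s" "sim a s"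
    for a b c s using c5 that unfolding C5'_def by blast
  show "C2 (uplus \<gamma>) (sim_star sim)"
    unfolding C2_def
  proof (intro allI impI, elim conjE)
    fix u v u1 v1 w w1
    assume "uplus \<gamma> u v = Some w" "uplus \<gamma> u1 v1 = Some w1"
      "sim_star sim u u1" "sim_star sim v v1"
    then show "sim_star sim w w1"
      \<comment> \<open>Three constructor patterns survive: \<open>Elem + Elem\<close> is C2 on P,
        \<open>Elem + Eta\<close> is right cancellation, and \<open>Eta + Elem\<close> is left
        cancellation after \<open>g\<close> has carried the relation of the summands in P over to
        their \<gamma>-images.\<close>
      by (cases u; cases v; cases u1; cases v1)
        (auto simp: uplus_iffs simp del: unitization_plus.simps(1-3)
          intro: C2D[OF c2] cancel_left[OF _ _ g[THEN iffD1]] cancel_right)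
  qed
  show "C3 (uplus \<gamma>) (sim_star sim)"
  proof (rule C3I)
    fix u v w u1
    assume sum: "uplus \<gamma> u v = Some w" and rel: "sim_star sim u1 u"
    show "\<exists>v1 t. sim_star sim v1 v \<and> uplus \<gamma> u1 v1 = Some t"
    proof (cases u)
      case u: (Elem a)
      then obtain a1 where u1: "u1 = Elem a1" and a1: "sim a1 a"
        using rel by (auto simp: sim_star_Elem_right)
      show ?thesis
      proof (cases v)
        case v: (Elem b)
        then obtain s where "a \<oplus> b = Some s" using sum u by (auto simp: uplus_iffs)
        then obtain b1 t where "sim b1 b" "a1 \<oplus> b1 = Some t" using C3_leftD[OF c3] a1 by metis
        then have "sim_star sim (Elem b1) v" "uplus \<gamma> u1 (Elem b1) = Some (Elem t)"
          using u1 v by auto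
        then show ?thesis by blast
      next
        case v: (Eta b)
        then obtain d where d: "d \<oplus> a = Some b" using sum u
          by (auto simp: uplus_Elem_Eta_iff simp del: unitization_plus.simps)
        \<comment> \<open>The replacement \<open>b1\<close> for \<open>b\<close> is built as a sum:
          keep \<open>a1\<close> as right summand and let C3 choose a left summand
          \<open>d1\<close>. C2 then gives \<open>b1 \<sim> b\<close>.\<close>
        then obtain d1 b1 where d1: "sim d1 d" "d1 \<oplus> a1 = Some b1"
          using C3_rightD[OF c3] a1 by metis
        then have "sim b1 b" using C2D[OF c2] d a1 by blast
        moreover have "uplus \<gamma> u1 (Eta b1) = Some (Eta d1)"
          using d1 u1 by (simp only: uplus_Elem_Eta_iff) blast
        ultimately show ?thesis using v by (metis sim_star.simps(2))
      qed
    next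
      case u: (Eta a)
      then obtain a1 where u1: "u1 = Eta a1" and a1: "sim a1 a"
        using rel by (auto simp: sim_star_Eta_right)
      from sum u obtain b d where v: "v = Elem b" and d: "\<gamma> b \<oplus> d = Some a"
        by (cases v) (auto simp: uplus_Eta_Elem_iff simp del: unitization_plus.simps(3))
      \<comment> \<open>Here \<open>a1\<close> is prescribed, so C5' must split it. The part
        \<open>x\<close> related to \<open>\<gamma> b\<close> has to be the \<gamma>-image of the
        new summand, which is therefore \<open>inv \<gamma> x\<close>.\<close>
      from split[OF d a1] obtain x y where xy: "x \<oplus> y = Some a1" "sim x (\<gamma> b)" by blast
      then have "sim (inv \<gamma> x) b" using g[of "inv \<gamma> x" b] by simp
      moreover have "uplus \<gamma> u1 (Elem (inv \<gamma> x)) = Some (Eta y)"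
        using xy u1 by (simp only: uplus_Eta_Elem_iff gamma_inv) blast
      ultimately show ?thesis using v by (metis sim_star.simps(1))
    qed
  next
    fix u v w v1
    assume sum: "uplus \<gamma> u v = Some w" and rel: "sim_star sim v1 v"
    show "\<exists>u1 t. sim_star sim u1 u \<and> uplus \<gamma> u1 v1 = Some t"
    proof (cases v)
      case v: (Elem b)
      then obtain b1 where v1: "v1 = Elem b1" and b1: "sim b1 b"
        using rel by (auto simp: sim_star_Elem_right)
      show ?thesis
      proof (cases u)
        case u: (Elem a)
        then obtain s where "a \<oplus> b = Some s" using sum v by (auto simp: uplus_iffs)
        then obtain a1 t where "sim a1 a" "a1 \<oplus> b1 = Some t" using C3_rightD[OF c3] b1 by metis
        then have "sim_star sim (Elem a1) u" "uplus \<gamma> (Elem a1) v1 = Some (Elem t)"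
          using v1 u by auto
        then show ?thesis by blast
      next
        case u: (Eta a)
        then obtain d where d: "\<gamma> b \<oplus> d = Some a" using sum v
          by (auto simp: uplus_Eta_Elem_iff simp del: unitization_plus.simps)
        have gb: "sim (\<gamma> b1) (\<gamma> b)" using b1 g by blast
        obtain d1 a1 where d1: "sim d1 d" "\<gamma> b1 \<oplus> d1 = Some a1"
          using C3_leftD[OF c3 d gb] by metis
        then have "sim a1 a" using C2D[OF c2] d gb by blast
        moreover have "uplus \<gamma> (Eta a1) v1 = Some (Eta d1)"
          using d1 v1 by (simp only: uplus_Eta_Elem_iff) blast
        ultimately show ?thesis using u by (metis sim_star.simps(2))
      qed
    next
      case v: (Eta b)
      then obtain b1 where v1: "v1 = Eta b1" and b1: "sim b1 b"
        using rel by (auto simp: sim_star_Eta_right)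
      from sum v obtain a d where u: "u = Elem a" and d: "d \<oplus> a = Some b"
        by (cases u) (auto simp: uplus_Elem_Eta_iff simp del: unitization_plus.simps(2))
      \<comment> \<open>Again the element under \<open>Eta\<close> is prescribed. C5' splits it, and
        the right part \<open>y\<close> becomes the new summand in P.\<close>
      from split[OF d b1] obtain x y where xy: "x \<oplus> y = Some b1" "sim y a" by blast
      then have "uplus \<gamma> (Elem y) v1 = Some (Eta x)"
        using v1 by (simp only: uplus_Elem_Eta_iff) blast
      with xy u show ?thesis by (metis sim_star.simps(1))
    qed
  qed
qed

section \<open>Necessity: consequences of the lifted relation being a congruence on U\<close>

context
  assumes star: "congruence (uplus \<gamma>) (sim_star sim)"
begin

lemma star_c2: "C2 (uplus \<gamma>) (sim_star sim)" and star_c3: "C3 (uplus \<gamma>) (sim_star sim)"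
  using star by (simp_all add: congruence_def)

text \<open>One half of C4: C2 on U applied to \<open>Elem a + Eta s = Eta x\<close> and
  \<open>Elem b + Eta t = Eta y\<close>.\<close>

lemma right_cancel_sim:
  assumes "x \<oplus> a = Some s" "y \<oplus> b = Some t" "sim a b" "sim s t"
  shows "sim x y"
proof -
  have "uplus \<gamma> (Elem a) (Eta s) = Some (Eta x)" "uplus \<gamma> (Elem b) (Eta t) = Some (Eta y)"
    using assms by (simp_all only: uplus_Elem_Eta_iff) blast+
  then show ?thesis using C2D[OF star_c2] assms by fastforce
qed

text \<open>In \<open>Eta s + Elem a\<close> the summand of P enters as \<open>\<gamma> a\<close>,
  whereas C2 on U compares \<open>a\<close> and \<open>b\<close> themselves. This is the other half
  of C4 up to \<gamma>, available before compatibility with \<gamma> is known.\<close>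

lemma left_cancel_gamma_sim:
  assumes "\<gamma> a \<oplus> x = Some s" "\<gamma> b \<oplus> y = Some t" "sim a b" "sim s t"
  shows "sim x y"
proof -
  have "uplus \<gamma> (Eta s) (Elem a) = Some (Eta x)" "uplus \<gamma> (Eta t) (Elem b) = Some (Eta y)"
    using assms by (simp_all only: uplus_Eta_Elem_iff) blast+
  then show ?thesis using C2D[OF star_c2] assms by fastforce
qed

lemma sum_Eta_inv_gamma: "uplus \<gamma> (Eta a) (Elem (inv \<gamma> a)) = Some (Eta zero)"
  by (simp add: uplus_Eta_Elem_iff neutral_right del: unitization_plus.simps)

text \<open>Exchanging \<open>Eta a\<close> for \<open>Eta b\<close> in
  \<open>Eta a + inv \<gamma> a = Eta zero\<close> changes the other summand to \<open>x\<close> and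
  the result to \<open>Eta y\<close>. Cancellation against the original sum makes \<open>y\<close>
  negligible.\<close>

lemma inv_gamma_summand:
  assumes "sim a b"
  obtains x y where "sim x (inv \<gamma> a)" "\<gamma> x \<oplus> y = Some b" "sim y zero"
proof -
  have "sim_star sim (Eta b) (Eta a)" using assms sim_sym by simp
  then obtain v w where vw: "sim_star sim v (Elem (inv \<gamma> a))" "uplus \<gamma> (Eta b) v = Some w"
    using C3_leftD[OF star_c3 sum_Eta_inv_gamma] by metis
  then obtain x where x: "v = Elem x" "sim x (inv \<gamma> a)" by (auto simp: sim_star_Elem_right)
  with vw obtain y where y: "\<gamma> x \<oplus> y = Some b"
    by (auto simp: uplus_Eta_Elem_iff simp del: unitization_plus.simps)
  have "\<gamma> (inv \<gamma> a) \<oplus> zero = Some a" by (simp add: neutral_right)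
  then have "sim y zero" using left_cancel_gamma_sim[OF y _ x(2)] assms sim_sym by blast
  with x y show thesis using that by blast
qed

text \<open>A summand of \<open>zero\<close> is \<open>zero\<close> by positivity, so the error term
  vanishes in this case. The general case uses this to control
  \<open>inv \<gamma> y\<close>.\<close>

lemma inv_gamma_sim_zero:
  assumes "sim a zero"
  shows "sim (inv \<gamma> a) zero"
proof -
  obtain x y where x: "sim x (inv \<gamma> a)" "\<gamma> x \<oplus> y = Some zero"
    using inv_gamma_summand[OF assms] by blast
  then have "\<gamma> x = zero" using positivity by blast
  then have "x = zero" using inv_gamma[of x] morphism_zero[OF inv_gamma_morphism] by simp
  then show ?thesis using x sim_sym by blast
qed

lemma inv_gamma_sim:
  assumes "sim a b"
  shows "sim (inv \<gamma> a) (inv \<gamma> b)"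
proof -
  obtain x y where x: "sim x (inv \<gamma> a)" and y: "\<gamma> x \<oplus> y = Some b" "sim y zero"
    using inv_gamma_summand[OF assms] by blast
  \<comment> \<open>Applying \<open>inv \<gamma>\<close> to \<open>\<gamma> x \<oplus> y = b\<close>
    also moves the error term, which stays negligible by the zero case.\<close>
  have "x \<oplus> inv \<gamma> y = Some (inv \<gamma> b)"
    using inv_gamma_morphism y(1) unfolding gpea_morphism_def by (metis inv_gamma)
  then have "sim x (inv \<gamma> b)"
    using sim_of_sum_negligible inv_gamma_sim_zero[OF y(2)] by blast
  then show ?thesis using x sim_sym sim_trans by blast
qed

text \<open>The other half of C3 is used: in \<open>Eta (\<gamma> a) + a = Eta zero\<close> the
  summand \<open>a\<close> is exchanged for \<open>b\<close>, and \<open>Eta (\<gamma> a)\<close>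
  adjusts to some \<open>Eta z\<close> with \<open>\<gamma> b \<le> z\<close>.\<close>

lemma gamma_sim:
  assumes "sim a b"
  shows "sim (\<gamma> a) (\<gamma> b)"
proof -
  have "uplus \<gamma> (Eta (\<gamma> a)) (Elem a) = Some (Eta zero)"
    using sum_Eta_inv_gamma[of "\<gamma> a"] by simp
  moreover have "sim_star sim (Elem b) (Elem a)" using assms sim_sym by simp
  ultimately obtain u w where u: "sim_star sim u (Eta (\<gamma> a))" "uplus \<gamma> u (Elem b) = Some w"
    using C3_rightD[OF star_c3] by metis
  then obtain z where z: "u = Eta z" "sim z (\<gamma> a)" by (auto simp: sim_star_Eta_right)
  with u obtain y where y: "\<gamma> b \<oplus> y = Some z"
    by (auto simp: uplus_Eta_Elem_iff simp del: unitization_plus.simps)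
  have "sim y zero"
    using left_cancel_gamma_sim[OF y neutral_right] assms z(2) sim_sym by blast
  then have "sim (\<gamma> b) z" using sim_of_sum_negligible y by blast
  then show ?thesis using z(2) sim_sym sim_trans by blast
qed

lemma gamma_sim_iff: "sim a b \<longleftrightarrow> sim (\<gamma> a) (\<gamma> b)"
  using gamma_sim inv_gamma_sim[of "\<gamma> a" "\<gamma> b"] by auto

lemma C4_of_star: "C4 oplus sim"
proof -
  have "sim x y" if "a \<oplus> x = Some s" "b \<oplus> y = Some t" "sim a b" "sim s t" for a b x y s t
    \<comment> \<open>Instantiating with preimages removes \<gamma> from the sums; the preimages are
      related by \<open>inv_gamma_sim\<close>.\<close>
    using left_cancel_gamma_sim[of "inv \<gamma> a" x s "inv \<gamma> b" y t] that inv_gamma_sim by simp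
  then show ?thesis unfolding C4_def using right_cancel_sim by blast
qed

text \<open>Exchanging \<open>Eta s\<close> for \<open>Eta a\<close> in
  \<open>Elem c + Eta s = Eta b\<close> yields a right summand of \<open>a\<close> related to
  \<open>c\<close>; right cancellation relates its complement to \<open>b\<close>.\<close>

lemma C5'_of_star: "C5' oplus sim"
  unfolding C5'_def
proof (intro allI impI, elim conjE)
  fix a b c s
  assume s: "b \<oplus> c = Some s" and as: "sim a s"
  have "uplus \<gamma> (Elem c) (Eta s) = Some (Eta b)"
    using s by (simp only: uplus_Elem_Eta_iff) blast
  moreover have "sim_star sim (Eta a) (Eta s)" using as by simp
  ultimately obtain u w where u: "sim_star sim u (Elem c)" "uplus \<gamma> u (Eta a) = Some w"
    using C3_rightD[OF star_c3] by metis
  then obtain x where x: "u = Elem x" "sim x c" by (auto simp: sim_star_Elem_right)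
  with u obtain d where d: "d \<oplus> x = Some a"
    by (auto simp: uplus_Elem_Eta_iff simp del: unitization_plus.simps)
  have "sim d b" using right_cancel_sim[OF d s x(2) as] .
  with d x show "\<exists>a1 a2. a1 \<oplus> a2 = Some a \<and> sim a1 b \<and> sim a2 c" by blast
qed

end

end

theorem theorem4p17:
  fixes oplus :: "'a \<Rightarrow> 'a \<Rightarrow> 'a option"
    and zero :: 'a
    and \<gamma> :: "'a \<Rightarrow> 'a"
    and sim :: "'a \<Rightarrow> 'a \<Rightarrow> bool"
  assumes "gpea oplus zero"
    and "unitizing_automorphism oplus \<gamma>"
    and "congruence oplus sim"
  shows "congruence (unitization_plus oplus \<gamma>) (sim_star sim) \<longleftrightarrow>
           gamma_congruence oplus \<gamma> sim \<and> C4 oplus sim \<and> C5' oplus sim"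
proof -
  interpret gpea_congruence oplus zero \<gamma> sim
    using assms by (simp add: gpea_congruence_def gpea_congruence_axioms_def)
  show ?thesis
    unfolding gamma_congruence_def
    using assms(3) congruence_sim_star gamma_sim_iff C4_of_star C5'_of_star by metis
qed

end
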